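(* Let $n\ge 1$ be an integer. Algorithm 1 (described in the context), applied to the complete list of the partitions of $n$, generates all the partitions of $n+1$ without omission or repetition; that is, every item it outputs is a partition of $n+1$, and every partition of $n+1$ occurs exactly once in the output list.
   Context: A partition of a positive integer $n$ is a representation of $n$ as a sum of positive integers (parts), the order of parts being irrelevant; it is written in non-increasing order $\alpha=\alpha_1+\alpha_2+\cdots+\alpha_k$ with $\alpha_1\ge\alpha_2\ge\cdots\ge\alpha_k\ge 1$, $k\geq 1$. Algorithm 1. Input: the list of all partitions of $n$ (each once). (1) Split the partitions $\alpha_1+\cdots+\alpha_k$ of $n$ into two groups: the first group consists of those with $k>1$ and $\alpha_k=\alpha_{k-1}$; the second group consists of those with $k=1$, or with $k>1$ and $\alpha_k<\alpha_{k-1}$. (2) From each partition $\alpha_1+\cdots+\alpha_k$ in the first group output exactly one partition of $n+1$, namely $\alpha_1+\cdots+\alpha_k+1$ (a separate part $1$ is added). (3) From each partition $\alpha_1+\cdots+\alpha_k$ in the second group output exactly two partitions of $n+1$: $\alpha_1+\cdots+\alpha_k+1$ (a separate part $1$ is added), and $\alpha_1+\cdots+\alpha_{k-1}+(\alpha_k+1)$ (the last part is increased by $1$). *)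

theory Defs
  imports Main
begin

text \<open>A partition is represented by the list of its parts in non-increasing order. The list is
  then determined by the partition, so equality of lists is equality of partitions.\<close>

definition is_partition :: "nat \<Rightarrow> nat list \<Rightarrow> bool" where
  "is_partition n a \<longleftrightarrow>
     a \<noteq> [] \<and> sorted_wrt (\<ge>) a \<and> (\<forall>x\<in>set a. x \<ge> 1) \<and> sum_list a = n"

text \<open>Lists are indexed from 0: with \<open>k = length a\<close>, the part \<open>\<alpha>\<^sub>k\<close> is \<open>a ! (k - 1)\<close>.\<close>

definition first_group :: "nat list \<Rightarrow> bool" where
  "first_group a \<longleftrightarrow>
     length a > 1 \<and> a ! (length a - 1) = a ! (length a - 2)"

definition second_group :: "nat list \<Rightarrow> bool" where
  "second_group a \<longleftrightarrow>
     length a = 1 \<or> (length a > 1 \<and> a ! (length a - 1) < a ! (length a - 2))"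

definition add_part_one :: "nat list \<Rightarrow> nat list" where
  "add_part_one a = a @ [1]"

definition increase_last :: "nat list \<Rightarrow> nat list" where
  "increase_last a = butlast a @ [last a + 1]"

definition algorithm1 :: "nat list list \<Rightarrow> nat list list" where
  "algorithm1 L =
     concat (map (\<lambda>a. [add_part_one a]) (filter first_group L)) @
     concat (map (\<lambda>a. [add_part_one a, increase_last a]) (filter second_group L))"

text \<open>A complete list of the partitions of \<open>n\<close>, as required for the input, exists.\<close>

lemma ex_partition_list: "\<exists>L. distinct L \<and> set L = {a. is_partition n a}"
proof -
  have len: "length a \<le> sum_list a" if "\<forall>x\<in>set a. x \<ge> 1" for a :: "nat list"
    using that by (induction a) auto
  have "{a. is_partition n a} \<subseteq> {a. set a \<subseteq> {..n} \<and> length a \<le> n}"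
    using len by (auto simp: is_partition_def member_le_sum_list)
  moreover have "finite {a :: nat list. set a \<subseteq> {..n} \<and> length a \<le> n}"
    by (rule finite_lists_length_le) simp
  ultimately have "finite {a. is_partition n a}"
    by (rule finite_subset)
  then show ?thesis
    using finite_distinct_list by blast
qed

end

theory Submission
  imports Defs
begin

text \<open>
  The algorithm is reversible, and the last part of an output shows how to reverse it. If a
  partition \<open>b\<close> of \<open>n + 1\<close> ends in \<open>1\<close>, then it can only come from adding a separate part, and
  deleting that part recovers its source (something is left, because \<open>n \<ge> 1\<close>). If \<open>b\<close> ends in
  some \<open>x \<ge> 2\<close>, then it can only come from increasing the last part, and its source ends in
  \<open>x - 1\<close>, which is strictly smaller than the part before it (if any); so the source lies in the
  second group. Hence the two operations are injective on partitions, with disjoint ranges, and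
  each is applied at most once to a partition because the two groups are disjoint; so nothing is
  repeated. Every partition of \<open>n + 1\<close> has a source, and the two groups together contain all
  partitions of \<open>n\<close>; so nothing is omitted. The second group is also
  exactly the set of partitions for which increasing the last part keeps the parts
  in non-increasing order, so every output is a partition.
\<close>

lemma is_partition_snoc:
  "is_partition n (c @ [x]) \<longleftrightarrow>
     sorted_wrt (\<ge>) c \<and> (\<forall>y\<in>set c. x \<le> y) \<and> 1 \<le> x \<and> sum_list c + x = n"
  by (auto simp: is_partition_def sorted_wrt_append)

lemma first_group_snoc: "first_group (c @ [x]) \<longleftrightarrow> c \<noteq> [] \<and> last c = x"
  by (cases c rule: rev_cases) (auto simp: first_group_def nth_append)

lemma second_group_snoc: "second_group (c @ [x]) \<longleftrightarrow> c = [] \<or> x < last c"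
  by (cases c rule: rev_cases) (auto simp: second_group_def nth_append)

lemma increase_last_snoc: "increase_last (c @ [x]) = c @ [x + 1]"
  by (simp add: increase_last_def)

lemma partition_snocE:
  assumes "is_partition n a"
  obtains c x where "a = c @ [x]"
  using assms by (cases a rule: rev_cases) (auto simp: is_partition_def)

text \<open>For a non-increasing list the last part is a lower bound of all parts, so the second group
  is the condition that the last part stays a lower bound after it has been increased.\<close>

lemma second_group_partition_snoc:
  assumes "is_partition n (c @ [x])"
  shows "second_group (c @ [x]) \<longleftrightarrow> (\<forall>y\<in>set c. x < y)"
  using assms unfolding second_group_snoc is_partition_snoc
  by (cases c rule: rev_cases) (auto simp: sorted_wrt_append)

lemma partition_in_exactly_one_group:
  assumes "is_partition n a"
  shows "first_group a \<longleftrightarrow> \<not> second_group a"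
proof -
  from assms obtain c x where a: "a = c @ [x]"
    by (rule partition_snocE)
  show ?thesis
    using assms unfolding a first_group_snoc second_group_snoc is_partition_snoc
    by (cases c rule: rev_cases) auto
qed

lemma is_partition_add_part_one:
  assumes "is_partition n a"
  shows "is_partition (n + 1) (add_part_one a)"
  using assms by (auto simp: is_partition_def add_part_one_def sorted_wrt_append)

lemma is_partition_increase_last:
  assumes "is_partition n a" and "second_group a"
  shows "is_partition (n + 1) (increase_last a)"
proof -
  from assms(1) obtain c x where a: "a = c @ [x]"
    by (rule partition_snocE)
  show ?thesis
    using assms second_group_partition_snoc[of n c x] unfolding a
    by (auto simp: increase_last_snoc is_partition_snoc Suc_le_eq)
qed

lemma inj_add_part_one: "inj add_part_one"
  by (auto simp: inj_def add_part_one_def)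

lemma inj_on_increase_last: "inj_on increase_last {a. is_partition n a}"
  by (auto simp: inj_on_def increase_last_snoc elim!: partition_snocE)

text \<open>The left-hand side ends in \<open>1\<close>; the right-hand side ends in a part that was already
  positive before it was increased.\<close>

lemma add_part_one_neq_increase_last:
  assumes "is_partition n a'"
  shows "add_part_one a \<noteq> increase_last a'"
proof -
  from assms obtain c x where a': "a' = c @ [x]"
    by (rule partition_snocE)
  show ?thesis
    using assms unfolding a'
    by (auto simp: add_part_one_def increase_last_snoc is_partition_snoc)
qed

text \<open>Reversing the algorithm. The assumption \<open>n \<ge> 1\<close> excludes the partition \<open>[1]\<close> of \<open>1\<close>,
  which becomes empty when its part \<open>1\<close> is deleted.\<close>

lemma partition_Suc_cases:
  assumes "n \<ge> 1" and "is_partition (n + 1) b"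
  obtains (add) a where "is_partition n a" "b = add_part_one a"
  | (increase) a where "is_partition n a" "second_group a" "b = increase_last a"
proof -
  from assms(2) obtain c x where b: "b = c @ [x]"
    by (rule partition_snocE)
  show thesis
  proof (cases "x = 1")
    case True
    with assms have "is_partition n c"
      by (auto simp: b is_partition_def sorted_wrt_append)
    with True show thesis
      by (intro add[of c]) (auto simp: b add_part_one_def)
  next
    case False
    with assms(2) have part: "is_partition n (c @ [x - 1])" and "x \<ge> 2"
      by (fastforce simp: b is_partition_snoc)+
    moreover have "\<forall>y\<in>set c. x - 1 < y"
      using assms(2) \<open>x \<ge> 2\<close> by (fastforce simp: b is_partition_snoc)
    ultimately show thesis
      using second_group_partition_snoc[OF part]
      by (intro increase[of "c @ [x - 1]"]) (auto simp: b increase_last_snoc)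
  qed
qed

lemma set_algorithm1:
  "set (algorithm1 L) =
     add_part_one ` {a \<in> set L. first_group a \<or> second_group a} \<union>
     increase_last ` {a \<in> set L. second_group a}"
  by (auto simp: algorithm1_def)

lemma distinct_concat_map_pair:
  assumes "distinct xs" "inj_on f (set xs)" "inj_on g (set xs)"
    and "\<And>x y. x \<in> set xs \<Longrightarrow> y \<in> set xs \<Longrightarrow> f x \<noteq> g y"
  shows "distinct (concat (map (\<lambda>x. [f x, g x]) xs))"
  using assms
proof (induction xs)
  case (Cons z zs)
  have "f z \<noteq> f x" "g z \<noteq> g x" "f z \<noteq> g x" "g z \<noteq> f x" if "x \<in> set zs" for x
    using Cons.prems that by (auto simp: inj_on_def) metis+
  moreover have "distinct (concat (map (\<lambda>x. [f x, g x]) zs))"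
    using Cons.prems by (intro Cons.IH) auto
  moreover have "f z \<noteq> g z"
    using Cons.prems(4) by simp
  ultimately show ?case
    by auto
qed simp

lemma distinct_algorithm1:
  assumes "distinct L" and part: "\<And>a. a \<in> set L \<Longrightarrow> is_partition n a"
  shows "distinct (algorithm1 L)"
proof -
  have "distinct (map add_part_one (filter first_group L))"
    using assms(1) by (simp add: distinct_map inj_on_subset[OF inj_add_part_one])
  moreover have
    "distinct (concat (map (\<lambda>a. [add_part_one a, increase_last a]) (filter second_group L)))"
  proof (rule distinct_concat_map_pair)
    show "inj_on increase_last (set (filter second_group L))"
      by (rule inj_on_subset[OF inj_on_increase_last[of n]]) (auto intro: part)
  qed (use assms in \<open>auto intro: inj_on_subset[OF inj_add_part_one]
         dest: add_part_one_neq_increase_last[OF part]\<close>)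
  moreover have "add_part_one a \<noteq> add_part_one a'"
    if "a \<in> set L" "first_group a" "second_group a'" for a a'
    using that partition_in_exactly_one_group[OF part] injD[OF inj_add_part_one] by blast
  moreover have "add_part_one a \<noteq> increase_last a'" if "a' \<in> set L" for a a'
    using add_part_one_neq_increase_last[OF part[OF that]] .
  ultimately show ?thesis
    by (auto simp: algorithm1_def)
qed

lemma count_list_distinct: "distinct xs \<Longrightarrow> x \<in> set xs \<Longrightarrow> count_list xs x = 1"
  by (induction xs) (auto simp: count_notin)

theorem mainTheorem1:
  fixes n :: nat and L :: "nat list list"
  assumes "n \<ge> 1"
    and "distinct L"
    and "set L = {a. is_partition n a}"
  shows "(\<forall>b \<in> set (algorithm1 L). is_partition (n + 1) b) \<and>
         (\<forall>b. is_partition (n + 1) b \<longrightarrow> count_list (algorithm1 L) b = 1)"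
proof (intro conjI ballI allI impI)
  fix b
  assume "b \<in> set (algorithm1 L)"
  then show "is_partition (n + 1) b"
    using is_partition_add_part_one[of n] is_partition_increase_last[of n]
    unfolding set_algorithm1 assms(3) by blast
next
  fix b
  assume "is_partition (n + 1) b"
  with assms(1) have "b \<in> set (algorithm1 L)"
  proof (cases rule: partition_Suc_cases)
    case (add a)
    then show ?thesis
      using partition_in_exactly_one_group[of n a] by (auto simp: set_algorithm1 assms(3))
  next
    case (increase a)
    then show ?thesis
      by (auto simp: set_algorithm1 assms(3))
  qed
  moreover have "distinct (algorithm1 L)"
    using assms(2,3) by (intro distinct_algorithm1[of L n]) auto
  ultimately show "count_list (algorithm1 L) b = 1"
    by (rule count_list_distinct[rotated])
qed

end
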